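(* Let $\lambda\in\mathbb{C}$, $r\in\mathbb{N}$ ($r\ge 1$) and $n\geq 0$. Here $L$ and $T_n$ act on row vectors by $Y\mapsto YL$ and $v\mapsto vT_n$, and kernels are taken with respect to this action. (1) If $Y\in\ell(\Gamma)$ and $Y\in\operatorname{Ker}(L-\lambda I)^r$, then $P_nY\in\operatorname{Ker}(T_n-\lambda I)^r$. (2) Conversely, if $v\in\operatorname{Ker}(T_n-\lambda I)^r$ and $\lambda\neq 0$, then $v$ can be extended to an infinite row vector $Y_v\in\ell(\Gamma)$ (i.e. $P_nY_v=v$) such that $Y_v\in\operatorname{Ker}(L-\lambda I)^r$. (3) If $\lambda\neq 0$, $Y\neq 0$ and $Y\in\operatorname{Ker}(L-\lambda I)^r$, then $P_nY\neq 0$. In particular, the extension $Y_v$ of $v$ in (2) is unique.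
   Context: $\Gamma\subset\mathbb{R}^d$ is a lattice (the image of $\mathbb{Z}^d$ under a nonsingular linear map) and $A$ is a dilation matrix associated to $\Gamma$: a $d\times d$ real matrix with $A(\Gamma)\subset\Gamma$ all of whose eigenvalues have modulus $>1$. $\Lambda\subset\Gamma$ is a finite nonempty set, $c_k\in\mathbb{C}$ for $k\in\Lambda$, and $c_k=0$ for $k\in\Gamma\setminus\Lambda$. $\ell(\Gamma)$ is the space of all complex sequences $Y=\{y_k\}_{k\in\Gamma}$, viewed as row vectors. $L=[c_{Ai-j}]_{i,j\in\Gamma}$; it acts by $(YL)_j=\sum_{i\in\Gamma}y_ic_{Ai-j}$ (a finite sum for each $j$). $I$ denotes the identity operator on the relevant space. For a finite nonempty $H\subset\Gamma$ and $B\subset\mathbb{R}^d$ let $w_H(B)=A^{-1}(B+H)$; $K_H$ is the unique nonempty compact set with $w_H(K_H)=K_H$, and $\Omega_H=K_H\cap\Gamma$. A set $\Omega\subset\Gamma$ is $H$-admissible if $w_H(\Omega)\cap\Gamma\subset\Omega$. $D\subset\Gamma$ is a full set of representatives of $\Gamma/A(\Gamma)$ with $0\in D$, such that the translates $K_D+k$, $k\in\Gamma$, of $Q=K_D$ cover $\mathbb{R}^d$ with overlaps of measure zero. $\Lambda'=\Lambda-D$ and $\Omega'=K_{\Lambda'}\cap\Gamma$. $\{\Omega_n\}_{n\ge0}$ is a fixed sequence of finite subsets of $\Gamma$ such that: $\Omega_0=\Omega_\Lambda$; $\Omega_i\subsetneq\Omega_{i+1}$ for all $i\ge 0$ and $\bigcup_i\Omega_i=\Gamma$;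 each $\Omega_i$ is $\Lambda$-admissible and $w_\Lambda(\Omega_{i+1})\cap\Gamma\subset\Omega_i$ for all $i\ge 0$; $\Omega_{n_0}=\Omega'$ for some index $n_0$; and for $i\ge n_0$, $\Omega_i$ is $\Lambda'$-admissible and $w_{\Lambda'}(\Omega_{i+1})\cap\Gamma\subset\Omega_i$. $T_n=[c_{Ai-j}]_{i,j\in\Omega_n}$ is the corresponding finite submatrix of $L$, and $P_n:\ell(\Gamma)\to\mathbb{C}^{1\times\Omega_n}$ is the restriction $P_nY=\{y_k\}_{k\in\Omega_n}$. *)

theory Defs
  imports "HOL-Analysis.Analysis"
begin

section \<open>Lattices, dilation matrices and attractors\<close>

definition is_lattice :: "(real^'d) set \<Rightarrow> bool" where
  "is_lattice \<Gamma> \<longleftrightarrow>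
     (\<exists>M :: real^'d^'d. invertible M \<and> \<Gamma> = (\<lambda>x. M *v x) ` {x. \<forall>i. x $ i \<in> \<int>})"

text \<open>Eigenvalues of a real matrix are the complex ones, i.e. those of its complexification.\<close>

definition complex_eigenvalue :: "real^'d^'d \<Rightarrow> complex \<Rightarrow> bool" where
  "complex_eigenvalue A z \<longleftrightarrow>
     (\<exists>v :: complex^'d. v \<noteq> 0 \<and> (\<chi> i j. complex_of_real (A $ i $ j)) *v v = z *s v)"

definition dilation_matrix :: "(real^'d) set \<Rightarrow> real^'d^'d \<Rightarrow> bool" where
  "dilation_matrix \<Gamma> A \<longleftrightarrow>
     (\<lambda>x. A *v x) ` \<Gamma> \<subseteq> \<Gamma> \<and> (\<forall>z. complex_eigenvalue A z \<longrightarrow> norm z > 1)"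

text \<open>\<open>wmap A H B\<close> is \<open>A\<^sup>-\<^sup>1(B + H)\<close>; a dilation matrix is invertible,
  so \<^const>\<open>matrix_inv\<close> is the genuine inverse.\<close>

definition wmap :: "real^'d^'d \<Rightarrow> (real^'d) set \<Rightarrow> (real^'d) set \<Rightarrow> (real^'d) set" where
  "wmap A H B = (\<lambda>x. matrix_inv A *v x) ` {b + h | b h. b \<in> B \<and> h \<in> H}"

text \<open>Meaningful for a dilation matrix \<open>A\<close> and finite nonempty \<open>H\<close>, where exactly one such
  set exists.\<close>

definition attractor :: "real^'d^'d \<Rightarrow> (real^'d) set \<Rightarrow> (real^'d) set" where
  "attractor A H = (THE K. compact K \<and> K \<noteq> {} \<and> wmap A H K = K)"

definition admissible ::
    "(real^'d) set \<Rightarrow> real^'d^'d \<Rightarrow> (real^'d) set \<Rightarrow> (real^'d) set \<Rightarrow> bool" where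
  "admissible \<Gamma> A H S \<longleftrightarrow> S \<subseteq> \<Gamma> \<and> wmap A H S \<inter> \<Gamma> \<subseteq> S"

definition full_representatives ::
    "(real^'d) set \<Rightarrow> real^'d^'d \<Rightarrow> (real^'d) set \<Rightarrow> bool" where
  "full_representatives \<Gamma> A D \<longleftrightarrow>
     D \<subseteq> \<Gamma> \<and> (\<forall>x\<in>\<Gamma>. \<exists>!d. d \<in> D \<and> x - d \<in> (\<lambda>y. A *v y) ` \<Gamma>)"

definition tiles :: "(real^'d) set \<Rightarrow> (real^'d) set \<Rightarrow> bool" where
  "tiles \<Gamma> Q \<longleftrightarrow>
     (\<Union>k\<in>\<Gamma>. (\<lambda>x. x + k) ` Q) = UNIV \<and>
     (\<forall>k\<in>\<Gamma>. \<forall>l\<in>\<Gamma>. k \<noteq> l \<longrightarrow>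
        negligible ((\<lambda>x. x + k) ` Q \<inter> (\<lambda>x. x + l) ` Q))"

section \<open>Row vectors, matrices and generalized left kernels\<close>

text \<open>A row vector indexed by \<open>S\<close> is a function vanishing off \<open>S\<close>. Thus \<open>row_vectors \<Gamma>\<close> is
  \<open>\<ell>(\<Gamma>)\<close>, and for finite \<open>S\<close>, \<open>row_vectors S\<close> is the space of complex \<open>1 \<times> S\<close> matrices.\<close>

definition row_vectors :: "'i set \<Rightarrow> ('i \<Rightarrow> complex) set" where
  "row_vectors S = {Y. \<forall>k. k \<notin> S \<longrightarrow> Y k = 0}"

definition restrict_row :: "'i set \<Rightarrow> ('i \<Rightarrow> complex) \<Rightarrow> 'i \<Rightarrow> complex" where
  "restrict_row S Y = (\<lambda>k. if k \<in> S then Y k else 0)"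

text \<open>Product \<open>Y M\<close> of a row vector with a matrix indexed by \<open>S \<times> S\<close> having finitely many nonzero
  entries in each column. Zero entries are dropped because \<^const>\<open>sum\<close> over an infinite
  index set is \<open>0\<close> by convention.\<close>

definition row_mult ::
    "'i set \<Rightarrow> ('i \<Rightarrow> 'i \<Rightarrow> complex) \<Rightarrow> ('i \<Rightarrow> complex) \<Rightarrow> 'i \<Rightarrow> complex" where
  "row_mult S M Y = (\<lambda>j. if j \<in> S then (\<Sum>i\<in>{i\<in>S. M i j \<noteq> 0}. Y i * M i j) else 0)"

text \<open>The kernel of \<open>(M - \<lambda>I)\<^sup>r\<close> acting on row vectors from the right, where \<open>M\<close> is
  indexed by \<open>S \<times> S\<close>.\<close>

definition gen_left_kernel ::
    "'i set \<Rightarrow> ('i \<Rightarrow> 'i \<Rightarrow> complex) \<Rightarrow> complex \<Rightarrow> nat \<Rightarrow> ('i \<Rightarrow> complex) set" where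
  "gen_left_kernel S M \<mu> r =
     {Y \<in> row_vectors S. ((\<lambda>X k. row_mult S M X k - \<mu> * X k) ^^ r) Y = (\<lambda>_. 0)}"

text \<open>The entries \<open>c\<^bsub>Ai-j\<^esub>\<close>. With index set \<open>\<Gamma>\<close> this is the matrix \<open>L\<close>, and with index set
  \<open>\<Omega>\<^sub>n\<close> its submatrix \<open>T\<^sub>n\<close>.\<close>

definition subdivision_matrix ::
    "real^'d^'d \<Rightarrow> (real^'d \<Rightarrow> complex) \<Rightarrow> real^'d \<Rightarrow> real^'d \<Rightarrow> complex" where
  "subdivision_matrix A c i j = c (A *v i - j)"

end

theory Submission
  imports Defs
begin

text \<open>
  The whole statement is about the shape of \<open>L\<close>. A nonzero entry \<open>c\<^bsub>Ai-j\<^esub>\<close> forces \<open>Ai - j \<in> \<Lambda>\<close>,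
  that is \<open>i \<in> A\<^sup>-\<^sup>1(j + \<Lambda>)\<close>. Admissibility therefore says that the columns indexed by \<open>\<Omega>\<^sub>n\<close> are
  supported in \<open>\<Omega>\<^sub>n\<close>, and the shrinking property says that the columns indexed by \<open>\<Omega>\<^sub>n\<^sub>+\<^sub>1\<close> are
  already supported in \<open>\<Omega>\<^sub>n\<close>: \<open>L\<close> is block upper triangular for the filtration \<open>\<Omega>\<close>, and its
  diagonal blocks on \<open>\<Omega>\<^sub>n\<^sub>+\<^sub>1 - \<Omega>\<^sub>n\<close> are zero. This is the locale below
  (lemma \<open>subdivision_matrix_staircase\<close>).

  Write \<open>N = L - \<mu>I\<close>. Triangularity makes \<open>P\<^sub>n\<close> intertwine \<open>N\<close> with \<open>T\<^sub>n - \<mu>I\<close>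
  (\<open>row_shift_pow_restrict\<close>), so restriction maps kernel to kernel. The zero diagonal blocks mean that, on rows vanishing on
  \<open>\<Omega>\<^sub>n\<close>, the operator \<open>N\<^sup>r\<close> is multiplication by \<open>(-\<mu>)\<^sup>r\<close> as far as the entries in \<open>\<Omega>\<^sub>n\<^sub>+\<^sub>1\<close> are
  concerned (\<open>row_shift_pow_next_layer\<close>). If \<open>\<mu> \<noteq> 0\<close> this is invertible. So a row of
  \<open>Ker N\<^sup>r\<close> that vanishes on \<open>\<Omega>\<^sub>n\<close> vanishes on each further layer in turn, and restriction is
  injective on the kernel.
  Likewise, if \<open>N\<^sup>r Y\<close> vanishes on \<open>\<Omega>\<^sub>n\<close>, then the correction \<open>Y - (-\<mu>)\<^sup>-\<^sup>r N\<^sup>r Y\<close> agrees with \<open>Y\<close> on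
  \<open>\<Omega>\<^sub>n\<close>, and its image under \<open>N\<^sup>r\<close> vanishes on \<open>\<Omega>\<^sub>n\<^sub>+\<^sub>1\<close>. Iterating the correction, starting from \<open>v\<close>
  extended by zero, fixes the entries layer by layer, and the eventual values form an extension
  of \<open>v\<close> in \<open>Ker N\<^sup>r\<close>.
\<close>

section \<open>The shifted operator and its powers\<close>

abbreviation row_shift ::
    "'i set \<Rightarrow> ('i \<Rightarrow> 'i \<Rightarrow> complex) \<Rightarrow> complex \<Rightarrow> ('i \<Rightarrow> complex) \<Rightarrow> 'i \<Rightarrow> complex" where
  "row_shift S M \<mu> \<equiv> \<lambda>X k. row_mult S M X k - \<mu> * X k"

lemma row_shift_pow_diff:
  "(row_shift S M \<mu> ^^ r) (\<lambda>k. X k - a * Y k)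
     = (\<lambda>k. (row_shift S M \<mu> ^^ r) X k - a * (row_shift S M \<mu> ^^ r) Y k)"
proof (induction r)
  case (Suc r)
  have "row_shift S M \<mu> (\<lambda>k. Z k - a * W k)
      = (\<lambda>k. row_shift S M \<mu> Z k - a * row_shift S M \<mu> W k)" for Z W
    by (auto simp: row_mult_def fun_eq_iff algebra_simps sum_subtractf sum_distrib_left)
  then show ?case
    using Suc.IH by simp
qed simp

lemma row_shift_pow_zero: "(row_shift S M \<mu> ^^ r) (\<lambda>_. 0) = (\<lambda>_. 0)"
  using row_shift_pow_diff[of r S M \<mu> "\<lambda>_. 0" 1 "\<lambda>_. 0"] by simp

lemma row_shift_pow_row_vectors:
  assumes "X \<in> row_vectors S"
  shows "(row_shift S M \<mu> ^^ r) X \<in> row_vectors S"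
  using assms by (induction r) (auto simp: row_vectors_def row_mult_def)

text \<open>If the columns indexed by \<open>S\<close> are supported in \<open>S\<close>, then the rows vanishing on \<open>S\<close> form an
  invariant subspace, and restriction to \<open>S\<close> is the passage to the quotient.\<close>

lemma row_shift_pow_restrict:
  assumes "S \<subseteq> G" and closed: "\<And>i j. i \<in> G \<Longrightarrow> j \<in> S \<Longrightarrow> M i j \<noteq> 0 \<Longrightarrow> i \<in> S"
  shows "(row_shift S M \<mu> ^^ r) (restrict_row S X) = restrict_row S ((row_shift G M \<mu> ^^ r) X)"
proof (induction r)
  case (Suc r)
  have "row_shift S M \<mu> (restrict_row S Z) = restrict_row S (row_shift G M \<mu> Z)" for Z
  proof
    fix j
    have "{i \<in> S. M i j \<noteq> 0} = {i \<in> G. M i j \<noteq> 0}" if "j \<in> S"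
      using that assms by blast
    moreover have "(\<Sum>i\<in>{i \<in> S. M i j \<noteq> 0}. restrict_row S Z i * M i j)
        = (\<Sum>i\<in>{i \<in> S. M i j \<noteq> 0}. Z i * M i j)"
      by (rule sum.cong) (auto simp: restrict_row_def)
    ultimately have "row_mult S M (restrict_row S Z) j = row_mult G M Z j" if "j \<in> S"
      using that \<open>S \<subseteq> G\<close> by (auto simp: row_mult_def)
    then show "row_shift S M \<mu> (restrict_row S Z) j = restrict_row S (row_shift G M \<mu> Z) j"
      by (auto simp: restrict_row_def row_mult_def)
  qed
  then show ?case
    using Suc.IH by simp
qed simp

section \<open>Block triangular matrices with vanishing diagonal blocks\<close>

text \<open>Only the first diagonal block, on \<open>S 0\<close>, may be nonzero; hence the separate assumption for it.\<close>

locale staircase_matrix =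
  fixes G :: "'i set" and S :: "nat \<Rightarrow> 'i set" and M :: "'i \<Rightarrow> 'i \<Rightarrow> complex"
  assumes layer_mono: "S m \<subseteq> S (Suc m)"
    and layers_exhaust: "(\<Union>m. S m) = G"
    and column_0: "i \<in> G \<Longrightarrow> j \<in> S 0 \<Longrightarrow> M i j \<noteq> 0 \<Longrightarrow> i \<in> S 0"
    and column_Suc: "i \<in> G \<Longrightarrow> j \<in> S (Suc m) \<Longrightarrow> M i j \<noteq> 0 \<Longrightarrow> i \<in> S m"
begin

lemma layer_subset: "S m \<subseteq> G"
  using layers_exhaust by blast

lemma layer_le: "m \<le> m' \<Longrightarrow> S m \<subseteq> S m'"
  using layer_mono by (rule lift_Suc_mono_le)

lemma column_closed: "i \<in> G \<Longrightarrow> j \<in> S m \<Longrightarrow> M i j \<noteq> 0 \<Longrightarrow> i \<in> S m"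
  using column_0 column_Suc layer_mono by (cases m) blast+

lemma in_some_later_layer:
  assumes "j \<in> G"
  obtains k where "j \<in> S (n + k)"
proof -
  obtain m where "j \<in> S m"
    using assms layers_exhaust by blast
  then have "j \<in> S (n + m)"
    using layer_le[of m "n + m"] by auto
  then show thesis ..
qed

lemma restrict_pow:
  "(row_shift (S m) M \<mu> ^^ r) (restrict_row (S m) X) = restrict_row (S m) ((row_shift G M \<mu> ^^ r) X)"
  by (rule row_shift_pow_restrict) (use layer_subset column_closed in auto)

lemma row_shift_pow_local:
  assumes "\<And>i. i \<in> S m \<Longrightarrow> X i = Y i" and "j \<in> S m"
  shows "(row_shift G M \<mu> ^^ r) X j = (row_shift G M \<mu> ^^ r) Y j"
proof -
  have "restrict_row (S m) X = restrict_row (S m) Y"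
    using assms(1) by (auto simp: restrict_row_def)
  then have "restrict_row (S m) ((row_shift G M \<mu> ^^ r) X) j
      = restrict_row (S m) ((row_shift G M \<mu> ^^ r) Y) j"
    using restrict_pow[where m = m and \<mu> = \<mu> and r = r and X = X] restrict_pow[where m = m and \<mu> = \<mu> and r = r and X = Y] by simp
  then show ?thesis
    using assms(2) by (simp add: restrict_row_def)
qed

text \<open>The columns of the next layer see only the entries on \<open>S m\<close>, which vanish for \<open>X\<close> and stay
  zero under the shifted operator; so each application only multiplies by \<open>-\<mu>\<close> there.\<close>

lemma row_shift_pow_next_layer:
  assumes zero: "\<And>i. i \<in> S m \<Longrightarrow> X i = 0" and j: "j \<in> S (Suc m)"
  shows "(row_shift G M \<mu> ^^ r) X j = (- \<mu>) ^ r * X j"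
proof (induction r)
  case (Suc r)
  have "(row_shift G M \<mu> ^^ r) X i = 0" if "i \<in> S m" for i
    using row_shift_pow_local[where m = m and X = X and Y = "\<lambda>_. 0" and j = i and \<mu> = \<mu> and r = r] zero that by (simp add: row_shift_pow_zero)
  then have "row_mult G M ((row_shift G M \<mu> ^^ r) X) j = 0"
    using column_Suc[OF _ j] by (auto simp: row_mult_def intro!: sum.neutral)
  then show ?case
    using Suc.IH by simp
qed simp

lemma kernel_restrict:
  assumes "Y \<in> gen_left_kernel G M \<mu> r"
  shows "restrict_row (S n) Y \<in> gen_left_kernel (S n) M \<mu> r"
proof -
  have "(row_shift (S n) M \<mu> ^^ r) (restrict_row (S n) Y) = restrict_row (S n) (\<lambda>_. 0)"
    using assms restrict_pow[where m = n and \<mu> = \<mu> and r = r and X = Y] by (simp add: gen_left_kernel_def)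
  then show ?thesis
    by (simp add: gen_left_kernel_def row_vectors_def restrict_row_def)
qed

lemma kernel_restrict_inj:
  assumes "\<mu> \<noteq> 0" and Y: "Y \<in> gen_left_kernel G M \<mu> r"
    and "restrict_row (S n) Y = (\<lambda>_. 0)"
  shows "Y = (\<lambda>_. 0)"
proof -
  have layer: "\<forall>j\<in>S (n + k). Y j = 0" for k
  proof (induction k)
    case 0
    then show ?case
      using assms(3) by (auto simp: restrict_row_def fun_eq_iff split: if_splits)
  next
    case (Suc k)
    have "(- \<mu>) ^ r * Y j = 0" if "j \<in> S (Suc (n + k))" for j
      using row_shift_pow_next_layer[where m = "n + k" and X = Y and j = j and \<mu> = \<mu> and r = r] Suc that Y
      by (simp add: gen_left_kernel_def)
    then show ?case
      using \<open>\<mu> \<noteq> 0\<close> by simp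
  qed
  show ?thesis
  proof
    fix j
    show "Y j = 0"
    proof (cases "j \<in> G")
      case True
      then obtain k where "j \<in> S (n + k)"
        by (rule in_some_later_layer)
      then show ?thesis
        using layer by blast
    next
      case False
      then show ?thesis
        using Y by (simp add: gen_left_kernel_def row_vectors_def)
    qed
  qed
qed

lemma kernel_extend:
  assumes "\<mu> \<noteq> 0" and v: "v \<in> gen_left_kernel (S n) M \<mu> r"
  obtains Y where "Y \<in> gen_left_kernel G M \<mu> r" and "restrict_row (S n) Y = v"
proof -
  define N where "N = row_shift G M \<mu> ^^ r"
  \<comment> \<open>\<open>F X\<close> removes the error \<open>N X\<close> on the first layer on which it is nonzero: there \<open>N\<close> maps the
    error to \<open>(-\<mu>)\<^sup>r\<close> times itself.\<close>
  define F where "F X = (\<lambda>j. X j - inverse ((- \<mu>) ^ r) * N X j)" for X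
  define V where "V k = (F ^^ k) v" for k
  have supp: "restrict_row (S n) v = v"
    using v by (auto simp: gen_left_kernel_def row_vectors_def restrict_row_def)
  have V_kernel: "\<forall>j\<in>S (n + k). N (V k) j = 0" for k
  proof (induction k)
    case 0
    have "restrict_row (S n) (N v) = (\<lambda>_. 0)"
      using restrict_pow[where m = n and \<mu> = \<mu> and r = r and X = v] v supp by (simp add: N_def gen_left_kernel_def)
    then show ?case
      by (auto simp: V_def restrict_row_def fun_eq_iff split: if_splits)
  next
    case (Suc k)
    show ?case
    proof
      fix j
      assume "j \<in> S (n + Suc k)"
      then have error: "N (N (V k)) j = (- \<mu>) ^ r * N (V k) j"
        using row_shift_pow_next_layer[where m = "n + k" and X = "N (V k)" and j = j and \<mu> = \<mu> and r = r] Suc by (simp add: N_def)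
      have "N (V (Suc k)) j = N (V k) j - inverse ((- \<mu>) ^ r) * N (N (V k)) j"
        by (simp add: V_def F_def N_def row_shift_pow_diff)
      then show "N (V (Suc k)) j = 0"
        using error \<open>\<mu> \<noteq> 0\<close> by simp
    qed
  qed
  have V_stable: "V (k + l) j = V k j" if "j \<in> S (n + k)" for k l j
  proof (induction l)
    case (Suc l)
    have "j \<in> S (n + (k + l))"
      using that layer_le[of "n + k" "n + (k + l)"] by auto
    then have "V (Suc (k + l)) j = V (k + l) j"
      using V_kernel[of "k + l"] by (simp add: V_def F_def)
    then show ?case
      using Suc by simp
  qed simp
  define Y where "Y j = (if j \<in> G then V (LEAST k. j \<in> S (n + k)) j else 0)" for j
  have Y_eq: "Y j = V k j" if "j \<in> S (n + k)" for j k
  proof -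
    define k0 where "k0 = (LEAST k. j \<in> S (n + k))"
    have "k0 \<le> k" and "j \<in> S (n + k0)"
      unfolding k0_def using that by (auto intro: Least_le LeastI)
    then show ?thesis
      using V_stable[of j k0 "k - k0"] that layer_subset by (auto simp: Y_def k0_def)
  qed
  have Y_rows: "Y \<in> row_vectors G"
    by (simp add: row_vectors_def Y_def)
  have "N Y j = 0" for j
  proof (cases "j \<in> G")
    case True
    then obtain k where "j \<in> S (n + k)"
      by (rule in_some_later_layer)
    then show ?thesis
      using row_shift_pow_local[where m = "n + k" and X = Y and Y = "V k" and j = j and \<mu> = \<mu> and r = r] Y_eq V_kernel by (simp add: N_def)
  next
    case False
    then show ?thesis
      using row_shift_pow_row_vectors[OF Y_rows] by (simp add: N_def row_vectors_def)
  qed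
  then have "Y \<in> gen_left_kernel G M \<mu> r"
    using Y_rows by (auto simp: gen_left_kernel_def N_def)
  moreover have "restrict_row (S n) Y = restrict_row (S n) v"
    using Y_eq[of _ 0] by (auto simp: restrict_row_def V_def)
  ultimately show thesis
    using that supp by simp
qed

lemma kernel_extend_unique:
  assumes "\<mu> \<noteq> 0" and Y: "Y \<in> gen_left_kernel G M \<mu> r" and Z: "Z \<in> gen_left_kernel G M \<mu> r"
    and eq: "restrict_row (S n) Y = restrict_row (S n) Z"
  shows "Y = Z"
proof -
  have "(\<lambda>k. Y k - 1 * Z k) \<in> gen_left_kernel G M \<mu> r"
    using Y Z row_shift_pow_diff[of r G M \<mu> Y 1 Z]
    by (simp add: gen_left_kernel_def row_vectors_def)
  moreover have "restrict_row (S n) (\<lambda>k. Y k - 1 * Z k) = (\<lambda>_. 0)"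
    using eq by (auto simp: restrict_row_def fun_eq_iff split: if_splits)
  ultimately have "(\<lambda>k. Y k - 1 * Z k) = (\<lambda>_. 0)"
    by (rule kernel_restrict_inj[OF \<open>\<mu> \<noteq> 0\<close>])
  then show ?thesis
    by (simp add: fun_eq_iff)
qed

end

section \<open>The subdivision matrix of a dilation\<close>

lemma lattice_diff:
  assumes "is_lattice \<Gamma>" "x \<in> \<Gamma>" "y \<in> \<Gamma>"
  shows "x - y \<in> \<Gamma>"
proof -
  obtain M :: "real^'a^'a" where M: "\<Gamma> = (\<lambda>x. M *v x) ` {x. \<forall>i. x $ i \<in> \<int>}"
    using assms(1) by (auto simp: is_lattice_def)
  obtain a b where "x = M *v a" "y = M *v b" and ab: "\<forall>i. a $ i \<in> \<int>" "\<forall>i. b $ i \<in> \<int>"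
    using assms(2,3) M by auto
  then have "x - y = M *v (a - b)"
    by (simp add: matrix_vector_mult_diff_distrib)
  moreover have "\<forall>i. (a - b) $ i \<in> \<int>"
    using ab by simp
  ultimately show ?thesis
    using M by blast
qed

text \<open>A real null vector of \<open>A\<close> would be a complex eigenvector for the eigenvalue \<open>0\<close>.\<close>

lemma dilation_matrix_inverse:
  fixes A :: "real^'d^'d"
  assumes "dilation_matrix \<Gamma> A"
  shows "matrix_inv A *v (A *v x) = x"
proof -
  have "v = 0" if "A *v v = 0" for v
  proof (rule ccontr)
    assume "v \<noteq> 0"
    define w :: "complex^'d" where "w = (\<chi> i. complex_of_real (v $ i))"
    have "(\<chi> i j. complex_of_real (A $ i $ j)) *v w = (\<chi> i. complex_of_real ((A *v v) $ i))"
      by (simp add: w_def matrix_vector_mult_def vec_eq_iff)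
    also have "\<dots> = 0 *s w"
      using that by (simp add: vec_eq_iff)
    finally have "(\<chi> i j. complex_of_real (A $ i $ j)) *v w = 0 *s w" .
    moreover have "w \<noteq> 0"
      using \<open>v \<noteq> 0\<close> by (auto simp: w_def vec_eq_iff)
    ultimately have "complex_eigenvalue A 0"
      unfolding complex_eigenvalue_def by blast
    then show False
      using assms by (auto simp: dilation_matrix_def)
  qed
  then have "invertible A"
    using matrix_left_invertible_ker invertible_left_inverse by blast
  then have "matrix_inv A ** A = mat 1"
    unfolding matrix_inv_def invertible_def by (rule someI2_ex) simp
  then show ?thesis
    by (simp add: matrix_vector_mul_assoc)
qed

text \<open>The values of \<open>c\<close> off \<open>\<Gamma>\<close> are arbitrary, so the argument needs \<open>Ai - j \<in> \<Gamma>\<close> before it can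
  conclude \<open>Ai - j \<in> \<Lambda>\<close>, that is \<open>i \<in> A\<^sup>-\<^sup>1(j + \<Lambda>)\<close>.\<close>

lemma subdivision_column_support:
  assumes "is_lattice \<Gamma>" "dilation_matrix \<Gamma> A" "B \<subseteq> \<Gamma>"
    and c_zero: "\<And>k. k \<in> \<Gamma> - \<Lambda> \<Longrightarrow> c k = 0"
    and "i \<in> \<Gamma>" "j \<in> B" "subdivision_matrix A c i j \<noteq> 0"
  shows "i \<in> wmap A \<Lambda> B \<inter> \<Gamma>"
proof -
  have "A *v i \<in> \<Gamma>"
    using assms by (auto simp: dilation_matrix_def)
  then have "A *v i - j \<in> \<Gamma>"
    using assms lattice_diff by blast
  then have "A *v i - j \<in> \<Lambda>"
    using assms by (auto simp: subdivision_matrix_def)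
  moreover have "A *v i = j + (A *v i - j)"
    by simp
  ultimately have "A *v i \<in> {b + h | b h. b \<in> B \<and> h \<in> \<Lambda>}"
    using \<open>j \<in> B\<close> by blast
  then have "matrix_inv A *v (A *v i) \<in> wmap A \<Lambda> B"
    unfolding wmap_def by (rule imageI)
  then show ?thesis
    using assms by (simp add: dilation_matrix_inverse)
qed

lemma subdivision_matrix_staircase:
  assumes "is_lattice \<Gamma>" "dilation_matrix \<Gamma> A"
    and "\<And>k. k \<in> \<Gamma> - \<Lambda> \<Longrightarrow> c k = 0"
    and mono: "\<And>i. \<Omega> i \<subseteq> \<Omega> (Suc i)" and exhausts: "(\<Union>i. \<Omega> i) = \<Gamma>"
    and admissible: "admissible \<Gamma> A \<Lambda> (\<Omega> 0)"
    and shrink: "\<And>i. wmap A \<Lambda> (\<Omega> (Suc i)) \<inter> \<Gamma> \<subseteq> \<Omega> i"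
  shows "staircase_matrix \<Gamma> \<Omega> (subdivision_matrix A c)"
proof
  have support: "i \<in> wmap A \<Lambda> (\<Omega> m) \<inter> \<Gamma>"
    if "i \<in> \<Gamma>" "j \<in> \<Omega> m" "subdivision_matrix A c i j \<noteq> 0" for i j m
  proof (rule subdivision_column_support[OF assms(1,2) _ assms(3)])
    show "\<Omega> m \<subseteq> \<Gamma>"
      using exhausts by blast
  qed (use that in auto)
  show "i \<in> \<Omega> 0" if "i \<in> \<Gamma>" "j \<in> \<Omega> 0" "subdivision_matrix A c i j \<noteq> 0" for i j
    using support[OF that] admissible by (auto simp: admissible_def)
  show "i \<in> \<Omega> m" if "i \<in> \<Gamma>" "j \<in> \<Omega> (Suc m)" "subdivision_matrix A c i j \<noteq> 0" for i j m
    using support[OF that] shrink by blast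
qed (use mono exhausts in auto)

theorem proposition3p1:
  fixes \<Gamma> \<Lambda> \<Lambda>' D :: "(real^'d) set"
    and A :: "real^'d^'d"
    and c :: "real^'d \<Rightarrow> complex"
    and \<Omega> :: "nat \<Rightarrow> (real^'d) set"
    and \<mu> :: complex
    and n\<^sub>0 n r :: nat
  defines "\<Lambda>' \<equiv> {l - d | l d. l \<in> \<Lambda> \<and> d \<in> D}"
  assumes lattice: "is_lattice \<Gamma>"
    and dilation: "dilation_matrix \<Gamma> A"
    and Lambda: "finite \<Lambda>" "\<Lambda> \<noteq> {}" "\<Lambda> \<subseteq> \<Gamma>"
    and c_zero: "\<And>k. k \<in> \<Gamma> - \<Lambda> \<Longrightarrow> c k = 0"
    and D: "full_representatives \<Gamma> A D" "0 \<in> D" "tiles \<Gamma> (attractor A D)"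
    and Omega_finite: "\<And>i. finite (\<Omega> i)" "\<And>i. \<Omega> i \<subseteq> \<Gamma>"
    and Omega_0: "\<Omega> 0 = attractor A \<Lambda> \<inter> \<Gamma>"
    and Omega_mono: "\<And>i. \<Omega> i \<subset> \<Omega> (Suc i)"
    and Omega_exhausts: "(\<Union>i. \<Omega> i) = \<Gamma>"
    and Omega_admissible: "\<And>i. admissible \<Gamma> A \<Lambda> (\<Omega> i)"
    and Omega_shrink: "\<And>i. wmap A \<Lambda> (\<Omega> (Suc i)) \<inter> \<Gamma> \<subseteq> \<Omega> i"
    and Omega_n0: "\<Omega> n\<^sub>0 = attractor A \<Lambda>' \<inter> \<Gamma>"
    and Omega_admissible': "\<And>i. i \<ge> n\<^sub>0 \<Longrightarrow> admissible \<Gamma> A \<Lambda>' (\<Omega> i)"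
    and Omega_shrink': "\<And>i. i \<ge> n\<^sub>0 \<Longrightarrow> wmap A \<Lambda>' (\<Omega> (Suc i)) \<inter> \<Gamma> \<subseteq> \<Omega> i"
    and r: "r \<ge> 1"
  defines "Ker_L \<equiv> gen_left_kernel \<Gamma> (subdivision_matrix A c) \<mu> r"
    and "Ker_T \<equiv> gen_left_kernel (\<Omega> n) (subdivision_matrix A c) \<mu> r"
    and "P \<equiv> restrict_row (\<Omega> n)"
  shows "(\<forall>Y\<in>Ker_L. P Y \<in> Ker_T) \<and>
    (\<mu> \<noteq> 0 \<longrightarrow> (\<forall>v\<in>Ker_T. \<exists>Y\<in>Ker_L. P Y = v)) \<and>
    (\<mu> \<noteq> 0 \<longrightarrow>
      (\<forall>Y\<in>Ker_L. Y \<noteq> (\<lambda>_. 0) \<longrightarrow> P Y \<noteq> (\<lambda>_. 0)) \<and>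
      (\<forall>v\<in>Ker_T. \<exists>!Y. Y \<in> Ker_L \<and> P Y = v))"
proof -
  interpret staircase_matrix \<Gamma> \<Omega> "subdivision_matrix A c"
    using lattice dilation c_zero psubset_imp_subset[OF Omega_mono] Omega_exhausts
      Omega_admissible Omega_shrink
    by (rule subdivision_matrix_staircase)
  have restrict: "P Y \<in> Ker_T" if "Y \<in> Ker_L" for Y
    using that unfolding Ker_L_def Ker_T_def P_def by (rule kernel_restrict)
  have extend: "\<exists>Y\<in>Ker_L. P Y = v" if "\<mu> \<noteq> 0" "v \<in> Ker_T" for v
    using kernel_extend[OF that[unfolded Ker_T_def]] unfolding Ker_L_def P_def by blast
  have nonzero: "P Y \<noteq> (\<lambda>_. 0)" if "\<mu> \<noteq> 0" "Y \<in> Ker_L" "Y \<noteq> (\<lambda>_. 0)" for Y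
    using kernel_restrict_inj[OF that(1) that(2)[unfolded Ker_L_def]] that(3)
    unfolding P_def by blast
  have unique: "Y = Z" if "\<mu> \<noteq> 0" "Y \<in> Ker_L" "Z \<in> Ker_L" "P Y = P Z" for Y Z
    using that unfolding Ker_L_def P_def by (rule kernel_extend_unique)
  have "\<exists>!Y. Y \<in> Ker_L \<and> P Y = v" if "\<mu> \<noteq> 0" "v \<in> Ker_T" for v
  proof -
    obtain Y where "Y \<in> Ker_L" "P Y = v"
      using extend \<open>\<mu> \<noteq> 0\<close> \<open>v \<in> Ker_T\<close> by blast
    then show ?thesis
      using unique[OF \<open>\<mu> \<noteq> 0\<close>] by (intro ex1I[of _ Y]) auto
  qed
  then show ?thesis
    by (intro conjI impI ballI restrict extend nonzero) simp_all
qed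

end
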